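(* There is no binary operator $>$ such that the language obtained by adding $>$ to the language generated by $\bot,\wedge,\to,\curlyvee,\Diamond^{+}$ is convex and satisfies both Modus Ponens and the Deduction Theorem for $>$.
   Context: Team semantics setting: a valuation is a function $v:Prop\to\{0,1\}$ over a finite set $Prop$ of propositional variables (formulas are built from $p\in Prop$), and a team is a set of valuations. Semantics: $T\models p$ iff $v(p)=1$ for all $v\in T$; $T\models\bot$ iff $T=\emptyset$; $T\models\varphi\wedge\psi$ iff $T\models\varphi$ and $T\models\psi$; $T\models\varphi\to\psi$ iff for all $S\subseteq T$, $S\models\varphi$ implies $S\models\psi$; $T\models\varphi\curlyvee\psi$ (outer global disjunction) iff there exists $S\supseteq T$ with $S\models\varphi$ or $S\models\psi$; $T\models\Diamond^{+}\varphi$ (epistemic might) iff there is a nonempty $S\subseteq T$ with $S\models\varphi$. A formula $\varphi$ is convex if $S\models\varphi$, $T\models\varphi$ and $S\subseteq R\subseteq T$ imply $R\models\varphi$; a language is convex if all its formulas are. Modus Ponens for $>$: $\varphi,\varphi>\psi\models\psi$ for all formulas $\varphi,\psi$ of the language. Deduction Theorem for $>$: if $\Gamma,\varphi\models\psi$ then $\Gamma\models\varphi>\psi$, for all formulas of the language. ($\Gamma\models\psi$ means every team satisfying all of $\Gamma$ satisfies $\psi$.) *)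

theory Defs
  imports Main
begin

text \<open>
  The propositional variables are the elements of a finite type \<open>'p\<close>, hence there is at least
  one. (Over an empty set of variables the only teams are the empty one and one singleton, every
  formula is convex, and material implication has both properties.)
\<close>

type_synonym 'p valuation = "'p \<Rightarrow> bool"
type_synonym 'p team = "'p valuation set"

datatype 'p fm =
    Var 'p
  | Bot  (\<open>\<^bold>\<bottom>\<close>)
  | And "'p fm" "'p fm"  (infixr \<open>\<^bold>\<and>\<close> 55)
  | Imp "'p fm" "'p fm"  (infixr \<open>\<^bold>\<rightarrow>\<close> 50)
  | ODisj "'p fm" "'p fm"  (infixr \<open>\<^bold>\<or>\<close> 53)
  | Might "'p fm"  (\<open>\<^bold>\<diamond>_\<close> [60] 60)
  | Gt "'p fm" "'p fm"  (infixr \<open>\<^bold>>\<close> 50)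

text \<open>
  The semantics of the added operator is the parameter \<open>gt\<close>: \<open>gt \<phi> \<psi>\<close> is the set of
  teams satisfying \<open>\<phi> \<^bold>> \<psi>\<close>. It is arbitrary, so that every semantic clause for the operator is
  covered; clauses that depend only on the sets of teams satisfying \<open>\<phi>\<close> and \<open>\<psi>\<close> are a special
  case.
\<close>

type_synonym 'p gt_semantics = "'p fm \<Rightarrow> 'p fm \<Rightarrow> 'p team set"

primrec sat :: "'p gt_semantics \<Rightarrow> 'p fm \<Rightarrow> 'p team \<Rightarrow> bool" where
  "sat gt (Var p) = (\<lambda>T. \<forall>v\<in>T. v p)"
| "sat gt \<^bold>\<bottom> = (\<lambda>T. T = {})"
| "sat gt (\<phi> \<^bold>\<and> \<psi>) = (\<lambda>T. sat gt \<phi> T \<and> sat gt \<psi> T)"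
| "sat gt (\<phi> \<^bold>\<rightarrow> \<psi>) = (\<lambda>T. \<forall>S\<subseteq>T. sat gt \<phi> S \<longrightarrow> sat gt \<psi> S)"
| "sat gt (\<phi> \<^bold>\<or> \<psi>) = (\<lambda>T. \<exists>S. T \<subseteq> S \<and> (sat gt \<phi> S \<or> sat gt \<psi> S))"
| "sat gt (\<^bold>\<diamond>\<phi>) = (\<lambda>T. \<exists>S\<subseteq>T. S \<noteq> {} \<and> sat gt \<phi> S)"
| "sat gt (\<phi> \<^bold>> \<psi>) = (\<lambda>T. T \<in> gt \<phi> \<psi>)"

definition entails :: "'p gt_semantics \<Rightarrow> 'p fm set \<Rightarrow> 'p fm \<Rightarrow> bool" where
  "entails gt \<Gamma> \<psi> \<longleftrightarrow> (\<forall>T. (\<forall>\<gamma>\<in>\<Gamma>. sat gt \<gamma> T) \<longrightarrow> sat gt \<psi> T)"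

definition convex_formula :: "'p gt_semantics \<Rightarrow> 'p fm \<Rightarrow> bool" where
  "convex_formula gt \<phi> \<longleftrightarrow>
     (\<forall>S R T. sat gt \<phi> S \<and> sat gt \<phi> T \<and> S \<subseteq> R \<and> R \<subseteq> T \<longrightarrow> sat gt \<phi> R)"

definition convex_language :: "'p gt_semantics \<Rightarrow> bool" where
  "convex_language gt \<longleftrightarrow> (\<forall>\<phi>. convex_formula gt \<phi>)"

definition modus_ponens :: "'p gt_semantics \<Rightarrow> bool" where
  "modus_ponens gt \<longleftrightarrow> (\<forall>\<phi> \<psi>. entails gt {\<phi>, \<phi> \<^bold>> \<psi>} \<psi>)"

definition deduction_theorem :: "'p gt_semantics \<Rightarrow> bool" where
  "deduction_theorem gt \<longleftrightarrow>
     (\<forall>\<Gamma> \<phi> \<psi>. entails gt (insert \<phi> \<Gamma>) \<psi> \<longrightarrow> entails gt \<Gamma> (\<phi> \<^bold>> \<psi>))"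

end

theory Submission imports Defs begin

text \<open>
  The formula \<open>p > \<bottom>\<close> holds in every team satisfying some \<open>\<chi>\<close> that is jointly inconsistent
  (beyond the empty team) with \<open>p\<close>. Taking \<open>\<chi> = \<bottom>\<close> it holds in the empty team, and taking
  \<open>\<chi> = \<diamond>\<not>p\<close> it holds in the full team. By convexity it holds in a nonempty team that
  satisfies \<open>p\<close>, where Modus Ponens gives \<open>\<bottom>\<close>.
\<close>

theorem theorem2:
  "\<not> (\<exists>gt :: 'p::finite gt_semantics.
        convex_language gt \<and> modus_ponens gt \<and> deduction_theorem gt)"
proof
  assume "\<exists>gt :: 'p gt_semantics. convex_language gt \<and> modus_ponens gt \<and> deduction_theorem gt"
  then obtain gt :: "'p gt_semantics"
    where conv: "convex_language gt" and mp: "modus_ponens gt" and dt: "deduction_theorem gt"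
    by blast
  fix p :: 'p
  let ?p = "Var p" and ?might_not = "\<^bold>\<diamond>(Var p \<^bold>\<rightarrow> \<^bold>\<bottom>)" and ?R = "{\<lambda>_. True} :: 'p team"
  have "entails gt {?p, \<^bold>\<bottom>} \<^bold>\<bottom>"
    by (simp add: entails_def)
  with dt have "entails gt {\<^bold>\<bottom>} (?p \<^bold>> \<^bold>\<bottom>)"
    unfolding deduction_theorem_def by blast
  then have empty: "sat gt (?p \<^bold>> \<^bold>\<bottom>) {}"
    by (simp add: entails_def)
  have "entails gt {?p, ?might_not} \<^bold>\<bottom>"
    unfolding entails_def
  proof (intro allI impI)
    fix T :: "'p team"
    assume "\<forall>\<gamma>\<in>{?p, ?might_not}. sat gt \<gamma> T"
    then obtain S where "S \<subseteq> T" "S \<noteq> {}" "sat gt (?p \<^bold>\<rightarrow> \<^bold>\<bottom>) S" "\<forall>v\<in>T. v p"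
      unfolding ball_simps sat.simps(1,6) by blast
    \<comment> \<open>\<open>Var p\<close> passes from \<open>T\<close> to its subteam
      \<open>S\<close>; the clause for the implication, applied to \<open>S\<close> as a subteam of
      itself, then forces \<open>S = {}\<close>.\<close>
    moreover from this have "sat gt ?p S"
      by auto
    ultimately have False
      unfolding sat.simps(2,4) by blast
    then show "sat gt \<^bold>\<bottom> T" ..
  qed
  with dt have "entails gt {?might_not} (?p \<^bold>> \<^bold>\<bottom>)"
    unfolding deduction_theorem_def by blast
  moreover have "sat gt ?might_not UNIV"
  proof -
    \<comment> \<open>The all-false valuation refutes \<open>p\<close>, so the only subteam of this
      singleton satisfying \<open>p\<close> is the empty one.\<close>
    have "sat gt (?p \<^bold>\<rightarrow> \<^bold>\<bottom>) {\<lambda>_. False}"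
      by (simp add: subset_singleton_iff)
    then show ?thesis
      unfolding sat.simps(6) by (intro exI[of _ "{\<lambda>_. False}"]) simp
  qed
  ultimately have "sat gt (?p \<^bold>> \<^bold>\<bottom>) UNIV"
    unfolding entails_def by blast
  \<comment> \<open>Every team lies between the empty team and \<open>UNIV\<close>, so any nonempty
    team satisfying \<open>p\<close> could serve as \<open>?R\<close>.\<close>
  with empty conv have "sat gt (?p \<^bold>> \<^bold>\<bottom>) ?R"
    unfolding convex_language_def convex_formula_def by (meson empty_subsetI subset_UNIV)
  moreover have "sat gt ?p ?R"
    by simp
  ultimately have "sat gt \<^bold>\<bottom> ?R"
    using mp unfolding modus_ponens_def entails_def by (metis insert_iff empty_iff)
  then show False
    by simp
qed

end
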